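(* Let $\mathbf{\Phi}$ be an irreducible and positive recurrent Markov chain of $GI/G/1$-type with transition matrix $$P=\begin{bmatrix} B_0 & B_1 & B_2 & B_3 & \cdots \\ B_{-1} & A_0 & A_1 & A_2 &\cdots \\ B_{-2} & A_{-1} & A_{0} & A_1 & \cdots \\ B_{-3} & A_{-2} & A_{-1} & A_0 & \cdots\\ \vdots & \vdots & \vdots & \vdots &\ddots \end{bmatrix},$$ and invariant probability vector $\boldsymbol\pi$ with level blocks $\boldsymbol\pi_0,\boldsymbol\pi_1,\dots$. Take $A=\ell(0)$ and $B=E\setminus \ell(0)$, and let $\widetilde X=\begin{bmatrix}\widetilde X_A\\ \widetilde X_B\end{bmatrix}$ be the matrix given by $$\widetilde{X}_{A}=\left(I-P^{(A)}\right)^{\#}\left(\left[I,\; P_{AB}\widehat{P}_{BB}\right]-\left(\boldsymbol e+P_{AB}\widehat{P}_{BB}\boldsymbol e\right)\boldsymbol\pi^T\right),\qquad \widetilde{X}_{B}=\widehat{P}_{BB}P_{BA}\widetilde{X}_A+\left[O,\;\widehat{P}_{BB}\right]-\widehat{P}_{BB}\boldsymbol e\,\boldsymbol \pi^T.$$ Then the $m\times m$ blocks $\widetilde X_{ij}$ (rows in level $\ell(i)$, columns in level $\ell(j)$) of $\widetilde X$ are $$\widetilde{X}_{ij}=\begin{cases} \left(I-P^{(0)}\right)^{\#}\left(I-\left(I+\sum_{m'=1}^{\infty}\sum_{n=1}^{\infty}B_{n}\widehat{H}_{nm'}\right) \boldsymbol{e}\boldsymbol{\pi}_0^{T}\right),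 & i=0,\ j=0,\\[1ex] \widetilde{X}_{00} \sum_{n=1}^{\infty}B_n\widehat{H}_{nj}, & i=0,\ j\ge 1,\\[1ex] \left(\sum_{m'=1}^{\infty} \widehat{H}_{im'}B_{-m'}\right)\widetilde{X}_{00}-\left(\sum_{m'=1}^{\infty} \widehat{H}_{im'}\right)\boldsymbol{e}\boldsymbol{\pi}_0^{T}, & i\ge 1,\ j=0,\\[1ex] \left(\sum_{m'=1}^{\infty} \widehat{H}_{im'}B_{-m'}\right)\widetilde{X}_{0j}+\widehat{H}_{ij}-\left(\sum_{m'=1}^{\infty} \widehat{H}_{im'}\right)\boldsymbol{e}\boldsymbol{\pi}_j^{T}, & i\ge 1,\ j\ge 1. \end{cases}$$
   Context: Markov chain of $GI/G/1$-type: a discrete-time Markov chain on $E=\bigcup_{i=0}^\infty \ell(i)$, with levels $\ell(i)=\{(i,j):1\le j\le m\}$, $m<\infty$, whose transition matrix has the displayed block form, where $\{B_i\}_{i\in\mathbb Z}$ and $\{A_i\}_{i\in\mathbb Z}$ are nonnegative $m\times m$ matrices such that $\sum_{i=0}^\infty B_i$, $B_{-j}+\sum_{i=-j+1}^\infty A_i$ (for $j\ge1$) and $\sum_{i=-\infty}^\infty A_i$ are stochastic. $\boldsymbol\pi$ is the unique invariant probability vector ($\boldsymbol\pi^TP=\boldsymbol\pi^T$, $\boldsymbol\pi^T\boldsymbol e=1$) and $\boldsymbol\pi_n$ is its restriction to $\ell(n)$. $\boldsymbol e$ is the column vector of ones, $I$ the identity matrix, $O$ the zero matrix, each of the size appropriate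 to the place where it occurs. $P_{A_1A_2}=(P(i,j))_{i\in A_1,j\in A_2}$ denotes blocks of $P$. $\widetilde X_A$ and $\widetilde X_B$ are the rows of $\widetilde X$ indexed by $A$ and by $B$ (with all columns in $E$); in a bracket $[\,\cdot\,,\,\cdot\,]$ the first block consists of the columns indexed by $A$ and the second of the columns indexed by $B$. $\widehat P_{BB}:=\sum_{k=0}^\infty P_{BB}^k$ (finite entrywise) and $P^{(A)}:=P_{AA}+P_{AB}\widehat P_{BB}P_{BA}$ is the transition matrix of the chain censored on $A$; for $A=\ell(0)$ it is written $P^{(0)}$. The group inverse $W^{\#}$ of a finite square matrix $W$ is the unique matrix with $WW^{\#}W=W$, $W^{\#}WW^{\#}=W^{\#}$, $W^{\#}W=WW^{\#}$. $H$ is the matrix obtained from $P$ by deleting the first block row and first block column (so $H=P_{BB}$ for $B=E\setminus\ell(0)$), i.e. its $(i,j)$ block is $A_{j-i}$ for $i,j\ge1$; $\widehat H:=\sum_{k=0}^\infty H^k$, with $m\times m$ blocks $\widehat H_{ij}$, $i,j\ge 1$. *)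

theory Defs
  imports "HOL-Analysis.Analysis"
begin

text \<open>
  A matrix whose rows and columns are indexed by (a subset of) a countable state space is a
  function \<open>'s \<Rightarrow> 's \<Rightarrow> real\<close>.  The submatrix with rows in one set and columns in another
  is not a separate object: the index set matters only where it is summed over, and it is
  recorded there.  Thus \<open>mult_on S M N\<close> is the product of a matrix with columns in \<open>S\<close> and
  one with rows in \<open>S\<close>.  A divergent \<open>infsum\<close> is \<open>0\<close>; for an irreducible positive
  recurrent \<open>P\<close> and a finite nonempty set \<open>A\<close>, all the series used below converge.
\<close>

definition mult_on :: "'s set \<Rightarrow> ('s \<Rightarrow> 's \<Rightarrow> real) \<Rightarrow> ('s \<Rightarrow> 's \<Rightarrow> real) \<Rightarrow> 's \<Rightarrow> 's \<Rightarrow> real" where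
  "mult_on S M N x y = (\<Sum>\<^sub>\<infinity>z\<in>S. M x z * N z y)"

definition id_mat :: "'s \<Rightarrow> 's \<Rightarrow> real" where
  "id_mat x y = (if x = y then 1 else 0)"

primrec pow_on :: "'s set \<Rightarrow> ('s \<Rightarrow> 's \<Rightarrow> real) \<Rightarrow> nat \<Rightarrow> 's \<Rightarrow> 's \<Rightarrow> real" where
  "pow_on S M 0 = id_mat"
| "pow_on S M (Suc k) = mult_on S M (pow_on S M k)"

text \<open>With rows and columns in \<open>S\<close>, \<open>hat_on S P\<close> is the sum of all powers of the
  submatrix of \<open>P\<close> on \<open>S\<close>.\<close>

definition hat_on :: "'s set \<Rightarrow> ('s \<Rightarrow> 's \<Rightarrow> real) \<Rightarrow> 's \<Rightarrow> 's \<Rightarrow> real" where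
  "hat_on S P x y = (\<Sum>\<^sub>\<infinity>k\<in>UNIV. pow_on S P k x y)"

definition censored :: "'s set \<Rightarrow> ('s \<Rightarrow> 's \<Rightarrow> real) \<Rightarrow> 's \<Rightarrow> 's \<Rightarrow> real" where
  "censored A P x y = P x y + mult_on (- A) (mult_on (- A) P (hat_on (- A) P)) P x y"

text \<open>The bracket \<open>[M, N]\<close>: columns in \<open>A\<close> come from \<open>M\<close>, the others from \<open>N\<close>.\<close>

definition join_cols :: "'s set \<Rightarrow> ('s \<Rightarrow> 's \<Rightarrow> real) \<Rightarrow> ('s \<Rightarrow> 's \<Rightarrow> real) \<Rightarrow> 's \<Rightarrow> 's \<Rightarrow> real" where
  "join_cols A M N x y = (if y \<in> A then M x y else N x y)"

definition irreducible_chain :: "('s \<Rightarrow> 's \<Rightarrow> real) \<Rightarrow> bool" where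
  "irreducible_chain P \<longleftrightarrow> (\<forall>x y. \<exists>n. pow_on UNIV P n x y > 0)"

text \<open>\<open>first_passage P y n x\<close> is the probability, starting from \<open>x\<close>, that the first visit to
  \<open>y\<close> at a positive time happens at time \<open>n + 1\<close>.\<close>

primrec first_passage :: "('s \<Rightarrow> 's \<Rightarrow> real) \<Rightarrow> 's \<Rightarrow> nat \<Rightarrow> 's \<Rightarrow> real" where
  "first_passage P y 0 = (\<lambda>x. P x y)"
| "first_passage P y (Suc n) = (\<lambda>x. \<Sum>\<^sub>\<infinity>z\<in>- {y}. P x z * first_passage P y n z)"

text \<open>Return is certain and the mean return time is finite.\<close>

definition positive_recurrent :: "('s \<Rightarrow> 's \<Rightarrow> real) \<Rightarrow> bool" where
  "positive_recurrent P \<longleftrightarrow>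
     (\<forall>x. (\<lambda>n. first_passage P x n x) sums 1 \<and>
          summable (\<lambda>n. real (n + 1) * first_passage P x n x))"

text \<open>For an irreducible positive recurrent chain exactly one \<open>\<pi>\<close> satisfies this.\<close>

definition invariant_prob :: "('s \<Rightarrow> 's \<Rightarrow> real) \<Rightarrow> ('s \<Rightarrow> real) \<Rightarrow> bool" where
  "invariant_prob P \<pi> \<longleftrightarrow>
     (\<forall>x. 0 \<le> \<pi> x) \<and> (\<pi> has_sum 1) UNIV \<and>
     (\<forall>y. ((\<lambda>x. \<pi> x * P x y) has_sum \<pi> y) UNIV)"

definition nonneg_mat :: "real^'m^'m \<Rightarrow> bool" where
  "nonneg_mat M \<longleftrightarrow> (\<forall>a b. 0 \<le> M $ a $ b)"

definition stochastic_mat :: "real^'m^'m \<Rightarrow> bool" where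
  "stochastic_mat M \<longleftrightarrow> nonneg_mat M \<and> M *v vec 1 = vec 1"

text \<open>A group inverse is unique if it exists; \<open>mat 1 - S\<close> has one for every stochastic
  matrix \<open>S\<close>.\<close>

definition group_inverse :: "real^'m^'m \<Rightarrow> real^'m^'m" where
  "group_inverse W = (THE G. W ** G ** W = W \<and> G ** W ** G = G \<and> G ** W = W ** G)"

definition outer :: "real^'m \<Rightarrow> real^'m \<Rightarrow> real^'m^'m" where
  "outer u v = (\<chi> a b. u $ a * v $ b)"

text \<open>States are pairs (level, phase), with phases in a finite type \<open>'m\<close>.  If one of the
  matrix series below diverges, its \<open>infsum\<close> is \<open>0\<close>; then the matrix in question has a row
  sum different from 1 (in the second condition by comparison with the third one, the series
  there being a subseries), so convergence is part of the assumption.\<close>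

definition gig1_blocks :: "(int \<Rightarrow> real^'m^'m) \<Rightarrow> (int \<Rightarrow> real^'m^'m) \<Rightarrow> bool" where
  "gig1_blocks A B \<longleftrightarrow>
     (\<forall>i. nonneg_mat (A i)) \<and> (\<forall>i. nonneg_mat (B i)) \<and>
     stochastic_mat (\<Sum>\<^sub>\<infinity>i\<in>{0..}. B i) \<and>
     (\<forall>j\<ge>1. stochastic_mat (B (- j) + (\<Sum>\<^sub>\<infinity>i\<in>{- j + 1..}. A i))) \<and>
     stochastic_mat (\<Sum>\<^sub>\<infinity>i\<in>UNIV. A i)"

definition gig1 :: "(int \<Rightarrow> real^'m^'m) \<Rightarrow> (int \<Rightarrow> real^'m^'m) \<Rightarrow> nat \<times> 'm \<Rightarrow> nat \<times> 'm \<Rightarrow> real" where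
  "gig1 A B = (\<lambda>(i, a) (j, b).
     (if i = 0 then B (int j)
      else if j = 0 then B (- int i)
      else A (int j - int i)) $ a $ b)"

definition level :: "nat \<Rightarrow> (nat \<times> 'm) set" where
  "level i = {i} \<times> UNIV"

definition block :: "(nat \<times> 'm \<Rightarrow> nat \<times> 'm \<Rightarrow> real) \<Rightarrow> nat \<Rightarrow> nat \<Rightarrow> real^'m^'m" where
  "block M i j = (\<chi> a b. M (i, a) (j, b))"

definition vblock :: "(nat \<times> 'm \<Rightarrow> real) \<Rightarrow> nat \<Rightarrow> real^'m" where
  "vblock v i = (\<chi> a. v (i, a))"

definition P0 :: "(nat \<times> 'm \<Rightarrow> nat \<times> 'm \<Rightarrow> real) \<Rightarrow> real^'m^'m" where
  "P0 P = block (censored (level 0) P) 0 0"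

text \<open>\<open>Hhat P i j\<close> is meant for \<open>i, j \<ge> 1\<close>.  Deleting the first block row and column of
  \<open>P\<close> amounts to restricting \<open>P\<close> to the complement of level 0.\<close>

definition Hhat :: "(nat \<times> 'm \<Rightarrow> nat \<times> 'm \<Rightarrow> real) \<Rightarrow> nat \<Rightarrow> nat \<Rightarrow> real^'m^'m" where
  "Hhat P i j = block (hat_on (- level 0) P) i j"

text \<open>The rows of the matrix \<open>Xt\<close> in level 0, resp. outside level 0, are those of \<open>Xt_A\<close>,
  resp. \<open>Xt_B\<close>; the columns range over all states.\<close>

definition Xt_A :: "(nat \<times> 'm::finite \<Rightarrow> nat \<times> 'm \<Rightarrow> real) \<Rightarrow> (nat \<times> 'm \<Rightarrow> real)
    \<Rightarrow> nat \<times> 'm \<Rightarrow> nat \<times> 'm \<Rightarrow> real" where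
  "Xt_A P \<pi> = (let A = level 0; B = - A; R = mult_on B P (hat_on B P) in
     mult_on A (\<lambda>x y. group_inverse (mat 1 - P0 P) $ snd x $ snd y)
       (\<lambda>x y. join_cols A id_mat R x y - (1 + (\<Sum>\<^sub>\<infinity>z\<in>B. R x z)) * \<pi> y))"

definition Xt_B :: "(nat \<times> 'm::finite \<Rightarrow> nat \<times> 'm \<Rightarrow> real) \<Rightarrow> (nat \<times> 'm \<Rightarrow> real)
    \<Rightarrow> nat \<times> 'm \<Rightarrow> nat \<times> 'm \<Rightarrow> real" where
  "Xt_B P \<pi> = (let A = level 0; B = - A; PB = hat_on B P in
     (\<lambda>x y. mult_on A (mult_on B PB P) (Xt_A P \<pi>) x y
        + join_cols A (\<lambda>_ _. 0) PB x y - (\<Sum>\<^sub>\<infinity>z\<in>B. PB x z) * \<pi> y))"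

definition Xt :: "(nat \<times> 'm::finite \<Rightarrow> nat \<times> 'm \<Rightarrow> real) \<Rightarrow> (nat \<times> 'm \<Rightarrow> real)
    \<Rightarrow> nat \<times> 'm \<Rightarrow> nat \<times> 'm \<Rightarrow> real" where
  "Xt P \<pi> x y = (if x \<in> level 0 then Xt_A P \<pi> x y else Xt_B P \<pi> x y)"

end

theory Submission
  imports Defs
begin

text \<open>
  Write \<open>A\<close> for level 0, \<open>B\<close> for the other states, \<open>R = P\<^sub>A\<^sub>B \<Sum>\<^sub>k P\<^sub>B\<^sub>B\<^sup>k\<close>, and \<open>G\<close> for
  the group inverse of \<open>I - P\<^sup>(\<^sup>0\<^sup>)\<close>.  The rows of \<open>X\<close> in level 0 have the blocks
  \<open>X\<^sub>0\<^sub>0 = G (I - u \<pi>\<^sub>0\<^sup>T)\<close> and \<open>X\<^sub>0\<^sub>j = G (R\<^sub>j - u \<pi>\<^sub>j\<^sup>T)\<close> with \<open>u = e + R e\<close>, where \<open>R\<^sub>j\<close> is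
  the part of \<open>R\<close> with columns in level \<open>j\<close>.  So \<open>X\<^sub>0\<^sub>j = X\<^sub>0\<^sub>0 R\<^sub>j\<close> follows from
  \<open>\<pi>\<^sub>0\<^sup>T R\<^sub>j = \<pi>\<^sub>j\<^sup>T\<close>: the invariant vector outside \<open>A\<close> is its restriction to \<open>A\<close> times the
  expected numbers of visits during an excursion from \<open>A\<close> (\<open>invariant_outside\<close>).  The
  remaining formulas are the definition of \<open>X\<close> written in blocks.

  There are two analytic points.  First, all the series must converge, because a divergent
  series has the value 0 here and its blocks and its entries would no longer agree.
  Second, iterating \<open>\<pi>\<^sub>B\<^sup>T = \<pi>\<^sub>A\<^sup>T P\<^sub>A\<^sub>B + \<pi>\<^sub>B\<^sup>T P\<^sub>B\<^sub>B\<close> leaves a remainder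
  \<open>\<pi>\<^sub>B\<^sup>T P\<^sub>B\<^sub>B\<^sup>n\<close>, which must tend to 0.  Both points are settled by Kac's argument
  (\<open>survival_summable\<close>).  Let \<open>q\<^sub>n(x)\<close> be the probability of staying in \<open>B\<close> at the times
  \<open>1, \<dots>, n\<close> when starting from \<open>x\<close>.  By invariance, \<open>\<Sum>\<^sub>a\<^sub>\<in>\<^sub>A \<pi>(a) q\<^sub>n\<^sub>+\<^sub>1(a)\<close> is the
  decrease of \<open>\<Sum>\<^sub>y\<^sub>\<in>\<^sub>B \<pi>(y) q\<^sub>n(y)\<close> from \<open>n\<close> to \<open>n + 1\<close>, so \<open>\<Sum>\<^sub>n q\<^sub>n(a)\<close> is finite for \<open>a\<close> in
  \<open>A\<close>, and by irreducibility for every state.  The row sums of \<open>P\<^sub>B\<^sub>B\<^sup>n\<close> are at most \<open>q\<^sub>n\<close>,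
  which gives the convergence of all the series; and \<open>q\<^sub>n \<rightarrow> 0\<close> gives the vanishing of the
  remainder, by dominated convergence.
\<close>

section \<open>Iterated sums of nonnegative reals\<close>

text \<open>Convergence of one iterated sum is enough for the interchange; that is the form in
  which sums over time and sums over states are exchanged below.\<close>

lemma tonelli_swap:
  fixes f :: "'a \<Rightarrow> 'b \<Rightarrow> real"
  assumes nonneg: "\<And>x y. x \<in> X \<Longrightarrow> y \<in> Y \<Longrightarrow> 0 \<le> f x y"
    and inner: "\<And>x. x \<in> X \<Longrightarrow> (f x has_sum g x) Y"
    and outer: "(g has_sum s) X"
  shows "((\<lambda>y. \<Sum>\<^sub>\<infinity>x\<in>X. f x y) has_sum s) Y"
proof -
  have "(\<lambda>(x, y). f x y) summable_on X \<times> Y"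
    using assms by (intro summable_on_SigmaI[where g = g]) (auto dest: has_sum_imp_summable)
  then have "((\<lambda>(x, y). f x y) has_sum s) (X \<times> Y)"
    using assms by (intro has_sum_SigmaI[where g = g]) auto
  then have yx: "((\<lambda>(y, x). f x y) has_sum s) (Y \<times> X)"
    by (subst has_sum_swap) simp
  have summable: "(\<lambda>x. f x y) summable_on X" if "y \<in> Y" for y
    using summable_on_SigmaD1[of "\<lambda>y x. f x y" Y "\<lambda>_. X" y] has_sum_imp_summable[OF yx] that
    by simp
  show "((\<lambda>y. \<Sum>\<^sub>\<infinity>x\<in>X. f x y) has_sum s) Y"
    using yx by (rule has_sum_SigmaD) (use summable in simp)
qed

text \<open>Dominated convergence: outside a finite set the weights have small total mass, and on
  a finite set the limit may be taken term by term.\<close>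

lemma weighted_sum_tendsto_0:
  fixes w :: "'a \<Rightarrow> real"
  assumes w: "w summable_on S" "\<And>x. x \<in> S \<Longrightarrow> 0 \<le> w x"
    and f: "\<And>n x. x \<in> S \<Longrightarrow> 0 \<le> f n x" "\<And>n x. x \<in> S \<Longrightarrow> f n x \<le> (1::real)"
    and lim: "\<And>x. x \<in> S \<Longrightarrow> (\<lambda>n. f n x) \<longlonglongrightarrow> 0"
  shows "(\<lambda>n. \<Sum>\<^sub>\<infinity>x\<in>S. w x * f n x) \<longlonglongrightarrow> 0"
proof (rule LIMSEQ_I)
  fix e :: real assume "e > 0"
  obtain F where F: "finite F" "F \<subseteq> S" "dist (sum w F) (infsum w S) \<le> e / 3"
    using infsum_finite_approximation[OF w(1), of "e / 3"] \<open>e > 0\<close> by auto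
  have wf: "(\<lambda>x. w x * f n x) summable_on T" if "T \<subseteq> S" for n T
    by (rule summable_on_subset_banach[OF _ that], rule summable_on_comparison_test[OF w(1)])
       (use w f in \<open>auto intro: mult_left_le\<close>)
  have wT: "w summable_on S - F"
    using w(1) by (rule summable_on_subset_banach) auto
  have tail: "infsum w (S - F) \<le> e / 3"
  proof -
    have "infsum w (S - F) = infsum w S - sum w F"
      using infsum_Diff[OF w(1) summable_on_finite[OF F(1)] F(2)] F(1) by simp
    then show ?thesis
      using abs_ge_self[of "infsum w S - sum w F"] F(3)
      by (simp only: dist_real_def abs_minus_commute)
  qed
  have "(\<lambda>n. \<Sum>x\<in>F. w x * f n x) \<longlonglongrightarrow> (\<Sum>x\<in>F. w x * 0)"
    using F(2) by (intro tendsto_intros lim) auto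
  then have "(\<lambda>n. \<Sum>x\<in>F. w x * f n x) \<longlonglongrightarrow> 0"
    by simp
  then obtain N where N: "\<And>n. n \<ge> N \<Longrightarrow> \<bar>\<Sum>x\<in>F. w x * f n x\<bar> < e / 3"
    using LIMSEQ_D[of _ 0 "e / 3"] \<open>e > 0\<close> by force
  have "norm ((\<Sum>\<^sub>\<infinity>x\<in>S. w x * f n x) - 0) < e" if "n \<ge> N" for n
  proof -
    have "(\<Sum>\<^sub>\<infinity>x\<in>S. w x * f n x) - (\<Sum>x\<in>F. w x * f n x) = (\<Sum>\<^sub>\<infinity>x\<in>S - F. w x * f n x)"
      using infsum_Diff[OF wf[OF subset_refl] summable_on_finite[OF F(1)] F(2)] F(1) by simp
    also have "\<dots> \<le> infsum w (S - F)"
      by (intro infsum_mono wf wT) (use w f in \<open>auto intro: mult_left_le\<close>)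
    finally have "(\<Sum>\<^sub>\<infinity>x\<in>S. w x * f n x) < e"
      using N[OF that] tail \<open>e > 0\<close> by simp
    moreover have "0 \<le> (\<Sum>\<^sub>\<infinity>x\<in>S. w x * f n x)"
      by (intro infsum_nonneg) (use w f in auto)
    ultimately show ?thesis by simp
  qed
  then show "\<exists>N. \<forall>n\<ge>N. norm ((\<Sum>\<^sub>\<infinity>x\<in>S. w x * f n x) - 0) < e" by blast
qed

section \<open>Excursions of a stationary chain outside a set of states\<close>

text \<open>\<open>survival S P n x\<close> is the probability, starting from \<open>x\<close>, that the chain is in \<open>S\<close>
  at all the times \<open>1, \<dots>, n\<close>.\<close>

primrec survival :: "'s set \<Rightarrow> ('s \<Rightarrow> 's \<Rightarrow> real) \<Rightarrow> nat \<Rightarrow> 's \<Rightarrow> real" where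
  "survival S P 0 = (\<lambda>_. 1)"
| "survival S P (Suc n) = (\<lambda>x. \<Sum>\<^sub>\<infinity>y\<in>S. P x y * survival S P n y)"

locale stationary_chain =
  fixes P :: "'s \<Rightarrow> 's \<Rightarrow> real" and \<pi> :: "'s \<Rightarrow> real" and A :: "'s set"
  assumes P_nonneg: "0 \<le> P x y"
    and P_summable: "P x summable_on UNIV"
    and P_sum_le_1: "infsum (P x) UNIV \<le> 1"
    and irreducible: "irreducible_chain P"
    and invariant: "invariant_prob P \<pi>"
    and A_nonempty: "A \<noteq> {}"
begin

lemma \<pi>_nonneg: "0 \<le> \<pi> x"
  and \<pi>_sum: "(\<pi> has_sum 1) UNIV"
  and \<pi>_inv: "((\<lambda>x. \<pi> x * P x y) has_sum \<pi> y) UNIV"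
  using invariant by (auto simp: invariant_prob_def)

lemma \<pi>_summable: "\<pi> summable_on S"
  using has_sum_imp_summable[OF \<pi>_sum] by (rule summable_on_subset_banach) simp

lemma P_summable_on: "P x summable_on S"
  using P_summable by (rule summable_on_subset_banach) simp

lemma P_le_1: "P x y \<le> 1"
proof -
  have "sum (P x) {y} \<le> infsum (P x) UNIV"
    by (intro finite_sum_le_infsum P_summable) (auto simp: P_nonneg)
  then show ?thesis using P_sum_le_1[of x] by simp
qed

lemma P_mult_summable:
  assumes "\<And>y. 0 \<le> f y" "\<And>y. f y \<le> 1"
  shows "(\<lambda>y. P x y * f y) summable_on S"
  by (rule summable_on_comparison_test[OF P_summable_on])
     (use assms P_nonneg in \<open>auto intro: mult_left_le\<close>)

text \<open>Irreducibility as an induction principle: a property that is passed on along the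
  transitions of positive probability holds everywhere as soon as it holds somewhere.\<close>

lemma reachable_induct [consumes 1, case_names step]:
  assumes "Q x" and step: "\<And>x y. Q x \<Longrightarrow> P x y > 0 \<Longrightarrow> Q y"
  shows "Q y"
proof -
  have "Q y" if "Q x" "pow_on UNIV P n x y > 0" for n x
    using that
  proof (induction n arbitrary: x)
    case 0
    then show ?case by (auto simp: id_mat_def split: if_splits)
  next
    case (Suc n)
    have "\<exists>z. P x z * pow_on UNIV P n z y > 0"
    proof (rule ccontr)
      assume "\<not> ?thesis"
      then have "P x z * pow_on UNIV P n z y \<le> 0" for z
        by (auto simp: not_less)
      then have "(\<Sum>\<^sub>\<infinity>z\<in>UNIV. P x z * pow_on UNIV P n z y) \<le> 0"
        using infsum_mono[of "\<lambda>z. P x z * pow_on UNIV P n z y" UNIV "\<lambda>_. 0"]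
        by (cases "(\<lambda>z. P x z * pow_on UNIV P n z y) summable_on UNIV")
           (auto simp: infsum_not_exists)
      then show False using Suc.prems by (simp add: mult_on_def)
    qed
    then obtain z where "P x z > 0" "pow_on UNIV P n z y > 0"
      using P_nonneg[of x] by (auto simp: zero_less_mult_iff not_less[symmetric])
    then show ?case using Suc step by blast
  qed
  then show ?thesis
    using irreducible assms(1) unfolding irreducible_chain_def by blast
qed

lemma \<pi>_pos: "\<pi> x > 0"
proof -
  obtain x\<^sub>0 where "\<pi> x\<^sub>0 > 0"
  proof (rule ccontr)
    assume "\<not> thesis"
    then have "\<pi> = (\<lambda>_. 0)" using that \<pi>_nonneg by (metis order_le_less)
    then show False using \<pi>_sum has_sum_unique[OF _ has_sum_0_simp] by fastforce
  qed
  then show ?thesis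
  proof (induction rule: reachable_induct)
    case (step x y)
    have "sum (\<lambda>x. \<pi> x * P x y) {x} \<le> \<pi> y"
      by (rule finite_sum_le_has_sum[OF \<pi>_inv]) (auto simp: \<pi>_nonneg P_nonneg)
    then show ?case using step by (smt (verit) mult_pos_pos sum.insert sum.empty empty_iff finite.emptyI)
  qed
qed

abbreviation q :: "nat \<Rightarrow> 's \<Rightarrow> real" where
  "q \<equiv> survival (- A) P"

lemma survival_nonneg: "0 \<le> q n x"
  by (induction n arbitrary: x) (auto intro!: infsum_nonneg simp: P_nonneg)

lemma survival_le_1: "q n x \<le> 1"
proof (induction n arbitrary: x)
  case (Suc n)
  have "q (Suc n) x \<le> infsum (P x) UNIV"
    unfolding survival.simps
    by (rule infsum_mono_neutral)
       (use Suc in \<open>auto intro!: P_mult_summable P_summable survival_nonneg mult_left_le simp: P_nonneg\<close>)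
  then show ?case using P_sum_le_1 order_trans by blast
qed simp

lemma survival_Suc_has_sum: "((\<lambda>y. P x y * q n y) has_sum q (Suc n) x) (- A)"
  using P_mult_summable[OF survival_nonneg survival_le_1] by simp

text \<open>If the chain starts from \<open>\<pi>\<close>, then it also has the distribution \<open>\<pi>\<close> at time 1, so
  being in \<open>-A\<close> at the times \<open>1, \<dots>, n + 1\<close> is as likely as at the times \<open>0, \<dots>, n\<close>.\<close>

lemma stationary_survival:
  "((\<lambda>x. \<pi> x * q (Suc n) x) has_sum (\<Sum>\<^sub>\<infinity>y\<in>-A. \<pi> y * q n y)) UNIV"
proof -
  have "((\<lambda>x. \<Sum>\<^sub>\<infinity>y\<in>-A. \<pi> x * P x y * q n y) has_sum (\<Sum>\<^sub>\<infinity>y\<in>-A. \<pi> y * q n y)) UNIV"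
  proof (rule tonelli_swap)
    show "((\<lambda>x. \<pi> x * P x y * q n y) has_sum \<pi> y * q n y) UNIV" for y
      by (intro has_sum_cmult_left \<pi>_inv)
    show "((\<lambda>y. \<pi> y * q n y) has_sum (\<Sum>\<^sub>\<infinity>y\<in>-A. \<pi> y * q n y)) (- A)"
      by (intro has_sum_infsum summable_on_comparison_test[OF \<pi>_summable])
         (auto simp: \<pi>_nonneg survival_nonneg survival_le_1 intro: mult_left_le)
  qed (auto simp: \<pi>_nonneg P_nonneg survival_nonneg)
  then show ?thesis
    by (simp add: mult.assoc infsum_cmult_right')
qed

text \<open>The sum is the expected time of the first visit to \<open>A\<close> after time 0.  Its finiteness is
  Kac's argument: in \<open>stationary_survival\<close>, the part of the sum over \<open>A\<close> is the difference
  of two consecutive terms of a nonnegative sequence, so its series over \<open>n\<close> converges.  This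
  settles the states of \<open>A\<close>.  A transition from \<open>x\<close> to \<open>y \<notin> A\<close> gives
  \<open>P(x, y) q\<^sub>n(y) \<le> q\<^sub>n\<^sub>+\<^sub>1(x)\<close>, and thus carries summability from \<open>x\<close> to \<open>y\<close>.\<close>

lemma survival_summable: "summable (\<lambda>n. q n x)"
proof -
  define s where "s n = (\<Sum>\<^sub>\<infinity>y\<in>-A. \<pi> y * q n y)" for n
  have on_A: "summable (\<lambda>n. q n a)" if "a \<in> A" for a
  proof -
    have drop: "\<pi> a * q (Suc n) a \<le> s n - s (Suc n)" for n
    proof -
      note st = stationary_survival[of n, folded s_def]
      have "((\<lambda>x. \<pi> x * q (Suc n) x) has_sum s (Suc n)) (- A)"
        unfolding s_def
        by (intro has_sum_infsum summable_on_subset_banach[OF has_sum_imp_summable[OF st]]) simp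
      then have "((\<lambda>x. \<pi> x * q (Suc n) x) has_sum (\<pi> a * q (Suc n) a + s (Suc n))) (insert a (- A))"
        using that by (intro has_sum_insert) auto
      then have "\<pi> a * q (Suc n) a + s (Suc n) \<le> s n"
        by (rule has_sum_mono2[OF _ st]) (auto simp: \<pi>_nonneg survival_nonneg simp del: survival.simps)
      then show ?thesis by simp
    qed
    have bound: "(\<Sum>k<n. q (Suc k) a) \<le> s 0 / \<pi> a" for n
    proof -
      have "\<pi> a * (\<Sum>k<n. q (Suc k) a) \<le> (\<Sum>k<n. s k - s (Suc k))"
        unfolding sum_distrib_left by (intro sum_mono drop)
      also have "\<dots> = s 0 - s n" by (rule sum_lessThan_telescope')
      also have "\<dots> \<le> s 0"
        by (auto simp: s_def \<pi>_nonneg survival_nonneg intro!: infsum_nonneg)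
      finally show ?thesis
        using \<pi>_pos[of a] survival_nonneg
        by (simp add: pos_le_divide_eq mult.commute del: survival.simps)
    qed
    have "summable (\<lambda>n. q (Suc n) a)"
      using survival_nonneg bound[of "Suc _"] unfolding lessThan_Suc_atMost
      by (rule bounded_imp_summable)
    then show ?thesis by (rule summable_Suc_iff[THEN iffD1])
  qed
  obtain a where "a \<in> A" using A_nonempty by blast
  then have "summable (\<lambda>n. q n a)" by (rule on_A)
  then show ?thesis
  proof (induction rule: reachable_induct)
    case (step x y)
    show ?case
    proof (cases "y \<in> A")
      case False
      have bound: "norm (q n y) \<le> q (Suc n) x / P x y" for n
      proof -
        have "sum (\<lambda>y. P x y * q n y) {y} \<le> q (Suc n) x"
          using survival_Suc_has_sum by (rule finite_sum_le_has_sum)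
            (use False in \<open>auto simp: P_nonneg survival_nonneg\<close>)
        then show ?thesis
          using step survival_nonneg by (simp add: field_simps del: survival.simps)
      qed
      have "summable (\<lambda>n. q (Suc n) x / P x y)"
        by (rule summable_divide, rule summable_Suc_iff[THEN iffD2], rule step)
      then show ?thesis by (rule summable_comparison_test'[where N = 0]) (rule bound)
    qed (rule on_A)
  qed
qed

lemma survival_tendsto_0: "(\<lambda>n. q n x) \<longlonglongrightarrow> 0"
  using survival_summable by (rule summable_LIMSEQ_zero)

abbreviation pw :: "nat \<Rightarrow> 's \<Rightarrow> 's \<Rightarrow> real" where
  "pw \<equiv> pow_on (- A) P"

lemma pow_nonneg: "0 \<le> pw n x y"
  by (induction n arbitrary: x) (auto simp: id_mat_def mult_on_def P_nonneg intro!: infsum_nonneg)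

text \<open>The row sums of \<open>P\<^sub>B\<^sub>B\<^sup>n\<close> are bounded through finite partial sums, because a bound on an
  infinite sum in the induction would need its convergence first.\<close>

lemma sum_pow_le_survival: "finite F \<Longrightarrow> sum (pw n x) F \<le> q n x"
proof (induction n arbitrary: x F)
  case 0
  then show ?case by (simp add: id_mat_def sum.If_cases)
next
  case (Suc n)
  have le1: "pw n y z \<le> 1" for y z
    using Suc.IH[of "{z}" y] survival_le_1[of n y] by simp
  have "((\<lambda>y. \<Sum>\<^sub>\<infinity>z\<in>F. P x y * pw n y z) has_sum (\<Sum>z\<in>F. pw (Suc n) x z)) (- A)"
  proof (rule tonelli_swap)
    show "((\<lambda>y. P x y * pw n y z) has_sum pw (Suc n) x z) (- A)" for z
      using P_mult_summable[OF pow_nonneg le1] by (simp add: mult_on_def)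
  qed (use Suc.prems P_nonneg pow_nonneg in auto)
  then show ?case
    using survival_Suc_has_sum
  proof (rule has_sum_mono)
    show "(\<Sum>\<^sub>\<infinity>z\<in>F. P x y * pw n y z) \<le> P x y * q n y" for y
      using Suc by (simp add: P_nonneg mult_left_mono flip: sum_distrib_left)
  qed
qed

lemma pow_le_survival: "pw n x y \<le> q n x"
  using sum_pow_le_survival[of "{y}"] by simp

lemma pow_le_1: "pw n x y \<le> 1"
  using pow_le_survival survival_le_1 order_trans by blast

lemma pow_Suc_has_sum: "((\<lambda>y. P x y * pw n y z) has_sum pw (Suc n) x z) (- A)"
  using P_mult_summable[OF pow_nonneg pow_le_1] by (simp add: mult_on_def)

abbreviation hat :: "'s \<Rightarrow> 's \<Rightarrow> real" where
  "hat \<equiv> hat_on (- A) P"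

text \<open>For \<open>z \<notin> A\<close>, \<open>R x z\<close> is the expected number of visits to \<open>z\<close> at positive times before
  the first positive time in \<open>A\<close>; hence the second form of the sum in \<open>R_has_sum_pow\<close>.\<close>

abbreviation R :: "'s \<Rightarrow> 's \<Rightarrow> real" where
  "R \<equiv> mult_on (- A) P hat"

lemma hat_has_sum: "((\<lambda>n. pw n x y) has_sum hat x y) UNIV"
  unfolding hat_on_def
proof (intro has_sum_infsum)
  have "summable (\<lambda>n. pw n x y)"
    by (rule summable_comparison_test[OF _ survival_summable[of x]])
       (auto simp: pow_nonneg pow_le_survival)
  then show "(\<lambda>n. pw n x y) summable_on UNIV"
    by (simp add: summable_on_UNIV_nonneg_real_iff pow_nonneg)
qed

lemma hat_nonneg: "0 \<le> hat x y"
  using hat_has_sum by (rule has_sum_nonneg) (simp add: pow_nonneg)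

lemma survival_has_sum: "((\<lambda>n. q n x) has_sum (\<Sum>n. q n x)) UNIV"
  by (intro sums_nonneg_imp_has_sum summable_sums survival_summable survival_nonneg)

lemma hat_summable: "hat x summable_on S"
proof (rule nonneg_bounded_partial_sums_imp_summable_on)
  show "\<forall>\<^sub>F F in finite_subsets_at_top S. sum (hat x) F \<le> (\<Sum>n. q n x)"
  proof (rule eventually_finite_subsets_at_top_weakI)
    fix F :: "'s set" assume F: "finite F"
    have "((\<lambda>n. \<Sum>\<^sub>\<infinity>y\<in>F. pw n x y) has_sum sum (hat x) F) UNIV"
      by (rule tonelli_swap[OF _ hat_has_sum]) (use F pow_nonneg in auto)
    then show "sum (hat x) F \<le> (\<Sum>n. q n x)"
      by (rule has_sum_mono[OF _ survival_has_sum]) (use F sum_pow_le_survival in auto)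
  qed
qed (simp add: hat_nonneg)

lemma survival_tail_has_sum: "((\<lambda>n. q (Suc n) x) has_sum (\<Sum>n. q (Suc n) x)) UNIV"
proof -
  have "summable (\<lambda>n. q (Suc n) x)"
    using survival_summable by (rule summable_Suc_iff[THEN iffD2])
  then show ?thesis
    by (intro sums_nonneg_imp_has_sum summable_sums survival_nonneg)
qed

lemma pow_tail_summable: "(\<lambda>n. pw (Suc n) x z) summable_on UNIV"
  by (rule summable_on_comparison_test[OF has_sum_imp_summable[OF survival_tail_has_sum[of x]]])
     (simp_all only: pow_le_survival pow_nonneg)

lemma R_has_sum: "((\<lambda>y. P x y * hat y z) has_sum R x z) (- A)"
  and R_has_sum_pow: "((\<lambda>n. pw (Suc n) x z) has_sum R x z) UNIV"
proof -
  have "((\<lambda>y. \<Sum>\<^sub>\<infinity>n\<in>UNIV. P x y * pw n y z) has_sum (\<Sum>\<^sub>\<infinity>n. pw (Suc n) x z)) (- A)"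
    by (rule tonelli_swap[OF _ pow_Suc_has_sum])
       (use pow_tail_summable in \<open>auto simp: P_nonneg pow_nonneg simp del: pow_on.simps\<close>)
  then have "((\<lambda>y. P x y * hat y z) has_sum (\<Sum>\<^sub>\<infinity>n. pw (Suc n) x z)) (- A)"
    by (simp add: infsum_cmult_right' hat_on_def del: pow_on.simps)
  moreover from this have "R x z = (\<Sum>\<^sub>\<infinity>n. pw (Suc n) x z)"
    unfolding mult_on_def by (rule infsumI)
  ultimately show "((\<lambda>y. P x y * hat y z) has_sum R x z) (- A)"
    "((\<lambda>n. pw (Suc n) x z) has_sum R x z) UNIV"
    using pow_tail_summable[of x z] by (simp_all del: pow_on.simps)
qed

lemma R_nonneg: "0 \<le> R x z"
  using R_has_sum_pow by (rule has_sum_nonneg) (simp only: pow_nonneg)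

lemma R_summable: "R x summable_on S"
proof (rule nonneg_bounded_partial_sums_imp_summable_on)
  show "\<forall>\<^sub>F F in finite_subsets_at_top S. sum (R x) F \<le> (\<Sum>n. q (Suc n) x)"
  proof (rule eventually_finite_subsets_at_top_weakI)
    fix F :: "'s set" assume F: "finite F"
    have "((\<lambda>n. \<Sum>\<^sub>\<infinity>z\<in>F. pw (Suc n) x z) has_sum sum (R x) F) UNIV"
      by (rule tonelli_swap[OF _ R_has_sum_pow]) (use F pow_nonneg[of "Suc _"] in auto)
    then show "sum (R x) F \<le> (\<Sum>n. q (Suc n) x)"
      by (rule has_sum_mono[OF _ survival_tail_has_sum])
         (simp only: F infsum_finite sum_pow_le_survival)
  qed
qed (simp add: R_nonneg)

text \<open>With \<open>\<alpha>\<^sub>n = \<pi>\<^sub>A\<^sup>T P\<^sub>A\<^sub>B P\<^sub>B\<^sub>B\<^sup>n\<close> and \<open>\<beta>\<^sub>n = \<pi>\<^sub>B\<^sup>T P\<^sub>B\<^sub>B\<^sup>n\<close>, invariance says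
  \<open>\<beta>\<^sub>n = \<alpha>\<^sub>n + \<beta>\<^sub>n\<^sub>+\<^sub>1\<close>.  Since \<open>\<beta>\<^sub>n \<rightarrow> 0\<close>, the sum of the \<open>\<alpha>\<^sub>n\<close> telescopes to \<open>\<beta>\<^sub>0\<close>, which is
  \<open>\<pi>\<close> on \<open>-A\<close>.\<close>

lemma invariant_outside:
  assumes "z \<in> - A"
  shows "((\<lambda>a. \<pi> a * R a z) has_sum \<pi> z) A"
proof -
  define \<alpha> where "\<alpha> n = (\<Sum>\<^sub>\<infinity>a\<in>A. \<pi> a * pw (Suc n) a z)" for n
  define \<beta> where "\<beta> n = (\<Sum>\<^sub>\<infinity>y\<in>-A. \<pi> y * pw n y z)" for n
  have summable: "(\<lambda>x. \<pi> x * pw n x z) summable_on S" for n S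
    by (rule summable_on_comparison_test[OF \<pi>_summable])
       (auto simp: \<pi>_nonneg pow_nonneg pow_le_1 intro: mult_left_le)
  have decomp: "\<beta> n = \<alpha> n + \<beta> (Suc n)" for n
  proof -
    have "((\<lambda>x. \<Sum>\<^sub>\<infinity>y\<in>-A. \<pi> x * P x y * pw n y z) has_sum \<beta> n) UNIV"
    proof (rule tonelli_swap)
      show "((\<lambda>x. \<pi> x * P x y * pw n y z) has_sum \<pi> y * pw n y z) UNIV" for y
        by (intro has_sum_cmult_left \<pi>_inv)
      show "((\<lambda>y. \<pi> y * pw n y z) has_sum \<beta> n) (- A)"
        unfolding \<beta>_def by (intro has_sum_infsum summable)
    qed (auto simp: \<pi>_nonneg P_nonneg pow_nonneg)
    then have "((\<lambda>x. \<pi> x * pw (Suc n) x z) has_sum \<beta> n) UNIV"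
      by (simp add: mult.assoc infsum_cmult_right' mult_on_def)
    moreover have "((\<lambda>x. \<pi> x * pw (Suc n) x z) has_sum (\<alpha> n + \<beta> (Suc n))) (A \<union> - A)"
      unfolding \<alpha>_def \<beta>_def by (intro has_sum_Un_disjoint has_sum_infsum summable) simp
    ultimately show ?thesis
      using has_sum_unique by fastforce
  qed
  have "\<beta> 0 = \<pi> z"
  proof -
    have "\<beta> 0 = (\<Sum>\<^sub>\<infinity>y\<in>{z}. \<pi> y)"
      unfolding \<beta>_def by (rule infsum_cong_neutral) (use assms in \<open>auto simp: id_mat_def\<close>)
    then show ?thesis by simp
  qed
  have "\<beta> \<longlonglongrightarrow> 0"
  proof (rule real_tendsto_sandwich[where f = "\<lambda>_. 0"])
    show "(\<lambda>n. \<Sum>\<^sub>\<infinity>y\<in>-A. \<pi> y * q n y) \<longlonglongrightarrow> 0"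
      by (intro weighted_sum_tendsto_0 \<pi>_summable \<pi>_nonneg survival_nonneg survival_le_1 survival_tendsto_0)
    have "\<beta> n \<le> (\<Sum>\<^sub>\<infinity>y\<in>-A. \<pi> y * q n y)" for n
      unfolding \<beta>_def
      by (intro infsum_mono summable summable_on_comparison_test[OF \<pi>_summable])
         (auto simp: \<pi>_nonneg survival_nonneg survival_le_1 pow_le_survival intro: mult_left_mono mult_left_le)
    then show "\<forall>\<^sub>F n in sequentially. \<beta> n \<le> (\<Sum>\<^sub>\<infinity>y\<in>-A. \<pi> y * q n y)" by simp
    show "\<forall>\<^sub>F n in sequentially. 0 \<le> \<beta> n"
      by (auto simp: \<beta>_def \<pi>_nonneg pow_nonneg intro!: always_eventually infsum_nonneg)
  qed simp
  then have "(\<lambda>n. \<beta> n - \<beta> (Suc n)) sums (\<beta> 0 - 0)"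
    by (rule telescope_sums')
  moreover have "\<beta> n - \<beta> (Suc n) = \<alpha> n" for n
    using decomp[of n] by linarith
  ultimately have "\<alpha> sums \<pi> z"
    using \<open>\<beta> 0 = \<pi> z\<close> by simp
  then have outer: "(\<alpha> has_sum \<pi> z) UNIV"
    by (rule sums_nonneg_imp_has_sum)
       (auto simp: \<alpha>_def \<pi>_nonneg pow_nonneg simp del: pow_on.simps intro!: infsum_nonneg)
  have "((\<lambda>a. \<Sum>\<^sub>\<infinity>n\<in>UNIV. \<pi> a * pw (Suc n) a z) has_sum \<pi> z) A"
  proof (rule tonelli_swap)
    show "((\<lambda>a. \<pi> a * pw (Suc n) a z) has_sum \<alpha> n) A" for n
      unfolding \<alpha>_def by (intro has_sum_infsum summable)
  qed (use outer in \<open>auto simp: \<pi>_nonneg pow_nonneg simp del: pow_on.simps\<close>)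
  moreover have "(\<Sum>\<^sub>\<infinity>n. \<pi> a * pw (Suc n) a z) = \<pi> a * R a z" for a
    using infsumI[OF R_has_sum_pow] by (simp add: infsum_cmult_right' del: pow_on.simps)
  ultimately show ?thesis by (simp del: pow_on.simps)
qed

lemma hat_P_has_sum: "((\<lambda>y. hat x y * P y z) has_sum mult_on (- A) hat P x z) (- A)"
  unfolding mult_on_def
  by (intro has_sum_infsum summable_on_comparison_test[OF hat_summable[of x]])
     (auto simp: hat_nonneg P_nonneg P_le_1 intro: mult_left_le)

end

section \<open>Block matrices\<close>

lemma has_sum_vec_iff:
  fixes f :: "'a \<Rightarrow> 'b::topological_comm_monoid_add ^ 'n"
  shows "(f has_sum s) S \<longleftrightarrow> (\<forall>i. ((\<lambda>k. f k $ i) has_sum s $ i) S)"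
proof -
  have component: "sum (\<lambda>k. f k $ i) = (\<lambda>F. sum f F $ i)" for i
    by (simp add: fun_eq_iff)
  show ?thesis
    unfolding has_sum_def component by (blast intro: vec_tendstoI tendsto_vec_nth)
qed

lemma matrix_has_sumI:
  fixes F :: "'a \<Rightarrow> real^'n^'k"
  assumes "\<And>a b. ((\<lambda>k. F k $ a $ b) has_sum M $ a $ b) S"
  shows "(F has_sum M) S"
  using assms by (simp add: has_sum_vec_iff)

lemma matrix_has_sumD:
  fixes F :: "'a \<Rightarrow> real^'n^'k"
  assumes "(F has_sum M) S"
  shows "((\<lambda>k. F k $ a $ b) has_sum M $ a $ b) S"
  using assms by (simp add: has_sum_vec_iff)

lemma outer_mult_matrix: "outer u v ** M = outer u (v v* M)"
  by (simp add: vec_eq_iff outer_def matrix_matrix_mult_def vector_matrix_mult_def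
      sum_distrib_left mult.assoc mult.left_commute)

lemma matrix_diff_rdistrib:
  fixes M N :: "real^'n^'k"
  shows "(M - N) ** K = M ** K - N ** K"
  by (simp add: vec_eq_iff matrix_matrix_mult_def left_diff_distrib sum_subtractf)

lemma matrix_mult_outer: "M ** outer u v = outer (M *v u) v"
  by (simp add: vec_eq_iff outer_def matrix_matrix_mult_def matrix_vector_mult_def
      sum_distrib_right mult.assoc)

lemma in_level_iff [simp]: "(i, a) \<in> level j \<longleftrightarrow> i = j"
  by (auto simp: level_def)

lemma Compl_level_0: "- level 0 = {1..} \<times> UNIV"
  by (auto simp: level_def)

lemma infsum_level: "(\<Sum>\<^sub>\<infinity>z\<in>level i. f z) = (\<Sum>c\<in>UNIV. f (i, c :: 'm :: finite) :: real)"
proof -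
  have "level i = Pair i ` (UNIV :: 'm set)" by (auto simp: level_def)
  then show ?thesis by (simp add: sum.reindex inj_on_def)
qed

lemma has_sum_by_levels:
  fixes f :: "nat \<times> 'm::finite \<Rightarrow> real"
  assumes "(f has_sum s) (- level 0)"
  shows "((\<lambda>k. \<Sum>c\<in>UNIV. f (k, c)) has_sum s) {1..}"
  using assms unfolding Compl_level_0 by (rule has_sum_SigmaD) simp

lemma infsum_by_phases:
  fixes f :: "nat \<times> 'm::finite \<Rightarrow> real"
  assumes f: "f summable_on - level 0"
  shows summable_phase: "\<And>c. (\<lambda>k. f (k, c)) summable_on {1..}"
    and "(\<Sum>c\<in>UNIV. \<Sum>\<^sub>\<infinity>k\<in>{1..}. f (k, c)) = (\<Sum>\<^sub>\<infinity>z\<in>-level 0. f z)"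
proof -
  have "(f has_sum (\<Sum>\<^sub>\<infinity>z\<in>-level 0. f z)) ({1..} \<times> UNIV)"
    using f by (metis Compl_level_0 has_sum_infsum)
  then have swapped: "((\<lambda>(c, k). f (k, c)) has_sum (\<Sum>\<^sub>\<infinity>z\<in>-level 0. f z)) (UNIV \<times> {1..})"
    by (subst has_sum_swap) simp
  show summable: "(\<lambda>k. f (k, c)) summable_on {1..}" for c
    using summable_on_SigmaD1[of "\<lambda>c k. f (k, c)" UNIV "\<lambda>_. {1..}" c] has_sum_imp_summable[OF swapped]
    by simp
  have "((\<lambda>c. \<Sum>\<^sub>\<infinity>k\<in>{1..}. f (k, c)) has_sum (\<Sum>\<^sub>\<infinity>z\<in>-level 0. f z)) UNIV"
    using swapped by (rule has_sum_SigmaD) (use summable in simp)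
  then show "(\<Sum>c\<in>UNIV. \<Sum>\<^sub>\<infinity>k\<in>{1..}. f (k, c)) = (\<Sum>\<^sub>\<infinity>z\<in>-level 0. f z)"
    by (simp add: has_sum_finite_iff)
qed

text \<open>A divergent series has the value 0, and the zero matrix is not stochastic.\<close>

lemma stochastic_summable:
  assumes "stochastic_mat (infsum F S)"
  shows "F summable_on S"
proof (rule ccontr)
  assume "\<not> F summable_on S"
  then have "stochastic_mat (0 :: real^'a^'a)" using assms by (simp add: infsum_not_exists)
  then show False by (simp add: stochastic_mat_def vec_eq_iff)
qed

text \<open>The rows of a block matrix are indexed by pairs, while the stochasticity conditions sum
  matrices over the levels first; nonnegativity makes the two ways of summing agree.\<close>

lemma stochastic_row_has_sum:
  fixes F :: "nat \<Rightarrow> real^'m^'m::finite"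
  assumes F: "(F has_sum M) UNIV" "\<And>k. nonneg_mat (F k)" and M: "stochastic_mat M"
  shows "((\<lambda>(k, c). F k $ a $ c) has_sum 1) UNIV"
proof -
  have "((\<lambda>c. \<Sum>\<^sub>\<infinity>k\<in>UNIV. F k $ a $ c) has_sum 1) UNIV"
  proof -
    have "(M *v vec 1) $ a = 1" using M by (simp add: stochastic_mat_def)
    then have "(\<Sum>c\<in>UNIV. M $ a $ c) = 1" by (simp add: matrix_vector_mult_def)
    then show ?thesis
      using infsumI[OF matrix_has_sumD[OF F(1)]] by (simp add: has_sum_finite_iff)
  qed
  moreover have "((\<lambda>k. F k $ a $ c) has_sum (\<Sum>\<^sub>\<infinity>k\<in>UNIV. F k $ a $ c)) UNIV" for c
    using matrix_has_sumD[OF F(1)] by (simp add: has_sum_iff)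
  ultimately have "((\<lambda>(c, k). F k $ a $ c) has_sum 1) (UNIV \<times> UNIV)"
    using F(2)
    by (intro has_sum_SigmaI summable_on_SigmaI)
       (auto simp: nonneg_mat_def dest: has_sum_imp_summable)
  then show ?thesis by (subst (asm) has_sum_swap) simp
qed

lemma gig1_row_has_sum:
  fixes A B :: "int \<Rightarrow> real^'m^'m::finite"
  assumes "gig1_blocks A B"
  shows "(gig1 A B x has_sum 1) UNIV"
proof -
  obtain i a where x: "x = (i, a)" by fastforce
  have nonneg: "nonneg_mat (A k)" "nonneg_mat (B k)" for k
    using assms by (auto simp: gig1_blocks_def)
  show ?thesis
  proof (cases "i = 0")
    case True
    have B: "stochastic_mat (\<Sum>\<^sub>\<infinity>k\<in>{0..}. B k)" using assms by (simp add: gig1_blocks_def)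
    have "(B has_sum (\<Sum>\<^sub>\<infinity>k\<in>{0..}. B k)) (range int)"
    proof -
      have "range int = {0..}" by (auto dest: zero_le_imp_eq_int)
      then show ?thesis using stochastic_summable[OF B] by simp
    qed
    then have "((\<lambda>k. B (int k)) has_sum (\<Sum>\<^sub>\<infinity>k\<in>{0..}. B k)) UNIV"
      by (subst (asm) has_sum_reindex) (auto simp: o_def)
    from stochastic_row_has_sum[OF this nonneg(2) B, of a] show ?thesis
      using True x by (simp add: gig1_def case_prod_unfold)
  next
    case False
    then have "int i \<ge> 1" by simp
    define S where "S = (\<Sum>\<^sub>\<infinity>k\<in>{- int i + 1..}. A k)"
    define F where "F k = (if k = 0 then B (- int i) else A (int k - int i))" for k :: nat
    have stoch: "stochastic_mat (B (- int i) + S)" "stochastic_mat (\<Sum>\<^sub>\<infinity>k. A k)"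
      using assms \<open>int i \<ge> 1\<close> by (auto simp: gig1_blocks_def S_def)
    have "A summable_on {- int i + 1..}"
      using stochastic_summable[OF stoch(2)] by (rule summable_on_subset_banach) simp
    then have "(A has_sum S) {- int i + 1..}"
      unfolding S_def by (rule has_sum_infsum)
    moreover have "{- int i + 1..} = (\<lambda>k. int k - int i) ` {1..}"
    proof
      show "{- int i + 1..} \<subseteq> (\<lambda>k. int k - int i) ` {1..}"
      proof
        fix k assume "k \<in> {- int i + 1..}"
        then show "k \<in> (\<lambda>k. int k - int i) ` {1..}"
          by (intro image_eqI[of _ _ "nat (k + int i)"]) auto
      qed
    qed auto
    ultimately have "((\<lambda>k. A (int k - int i)) has_sum S) {1..}"
      using has_sum_reindex[of "\<lambda>k. int k - int i" "{1..}" A S] by (simp add: inj_on_def o_def)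
    then have "(F has_sum S) {1..}"
      by (rule has_sum_cong[THEN iffD1, rotated]) (simp add: F_def)
    then have "(F has_sum (F 0 + S)) (insert 0 {1..})"
      by (intro has_sum_insert) auto
    moreover have "insert 0 {1..} = (UNIV :: nat set)" by auto
    ultimately have F_sum: "(F has_sum (B (- int i) + S)) UNIV" by (simp add: F_def)
    have "nonneg_mat (F k)" for k using nonneg by (simp add: F_def)
    from stochastic_row_has_sum[OF F_sum this stoch(1), of a] show ?thesis
      using False by (simp add: x gig1_def F_def case_prod_unfold cong: if_cong)
  qed
qed

theorem theorem4p1:
  fixes A B :: "int \<Rightarrow> real^'m^'m::finite"
    and P :: "nat \<times> 'm \<Rightarrow> nat \<times> 'm \<Rightarrow> real"
    and \<pi> :: "nat \<times> 'm \<Rightarrow> real"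
    and X :: "nat \<Rightarrow> nat \<Rightarrow> real^'m^'m"
  assumes blocks: "gig1_blocks A B"
    and P: "P = gig1 A B"
    and irred: "irreducible_chain P"
    and posrec: "positive_recurrent P"
    and inv: "invariant_prob P \<pi>"
    and X: "X = block (Xt P \<pi>)"
  shows
    "X 0 0 = group_inverse (mat 1 - P0 P) **
       (mat 1 - (mat 1 + (\<Sum>\<^sub>\<infinity>k\<in>{1..}. \<Sum>\<^sub>\<infinity>n\<in>{1..}. B (int n) ** Hhat P n k))
                ** outer (vec 1) (vblock \<pi> 0))
     \<and> (\<forall>j\<ge>1. X 0 j = X 0 0 ** (\<Sum>\<^sub>\<infinity>n\<in>{1..}. B (int n) ** Hhat P n j))
     \<and> (\<forall>i\<ge>1. X i 0 =
          (\<Sum>\<^sub>\<infinity>k\<in>{1..}. Hhat P i k ** B (- int k)) ** X 0 0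
          - (\<Sum>\<^sub>\<infinity>k\<in>{1..}. Hhat P i k) ** outer (vec 1) (vblock \<pi> 0))
     \<and> (\<forall>i\<ge>1. \<forall>j\<ge>1. X i j =
          (\<Sum>\<^sub>\<infinity>k\<in>{1..}. Hhat P i k ** B (- int k)) ** X 0 j
          + Hhat P i j
          - (\<Sum>\<^sub>\<infinity>k\<in>{1..}. Hhat P i k) ** outer (vec 1) (vblock \<pi> j))"
proof -
  define H where "H = hat_on (- level 0) P"
  define R where "R = mult_on (- level 0) P H"
  define L where "L = mult_on (- level 0) H P"
  define G where "G = group_inverse (mat 1 - P0 P)"
  define u :: "real^'m" where "u = (\<chi> c. 1 + (\<Sum>\<^sub>\<infinity>z\<in>-level 0. R (0, c) z))"
  define h :: "nat \<Rightarrow> real^'m" where "h i = (\<chi> c. \<Sum>\<^sub>\<infinity>z\<in>-level 0. H (i, c) z)" for i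
  have rows: "(P x has_sum 1) UNIV" for x
    unfolding P by (rule gig1_row_has_sum[OF blocks])
  interpret stationary_chain P \<pi> "level 0"
  proof
    show "0 \<le> P x y" for x y
      using blocks by (auto simp: P gig1_def gig1_blocks_def nonneg_mat_def split: prod.splits)
    show "P x summable_on UNIV" "infsum (P x) UNIV \<le> 1" for x
      using rows[of x] by (auto simp: has_sum_iff)
    show "level 0 \<noteq> ({} :: (nat \<times> 'm) set)" by (simp add: level_def)
  qed (fact irred inv)+

  \<comment> \<open>The block series of the statement are blocks of the products over the states of positive
    level: \<open>R = P\<^sub>A\<^sub>B H\<close> and \<open>L = H P\<^sub>B\<^sub>A\<close>.\<close>
  have BH: "((\<lambda>n. B (int n) ** Hhat P n j) has_sum block R 0 j) {1..}" for j
  proof (rule matrix_has_sumI)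
    fix a b
    have "((\<lambda>n. \<Sum>c\<in>UNIV. P (0, a) (n, c) * H (n, c) (j, b)) has_sum R (0, a) (j, b)) {1..}"
      using R_has_sum unfolding R_def H_def by (rule has_sum_by_levels)
    then show "((\<lambda>n. (B (int n) ** Hhat P n j) $ a $ b) has_sum block R 0 j $ a $ b) {1..}"
      by (simp add: matrix_matrix_mult_def Hhat_def block_def P gig1_def H_def)
  qed
  have HB: "((\<lambda>k. Hhat P i k ** B (- int k)) has_sum block L i 0) {1..}" for i
  proof (rule matrix_has_sumI)
    fix a b
    have "((\<lambda>k. \<Sum>c\<in>UNIV. H (i, a) (k, c) * P (k, c) (0, b)) has_sum L (i, a) (0, b)) {1..}"
      using hat_P_has_sum unfolding L_def H_def by (rule has_sum_by_levels)
    moreover have entry: "(Hhat P i k ** B (- int k)) $ a $ b = (\<Sum>c\<in>UNIV. H (i, a) (k, c) * P (k, c) (0, b))"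
      if "k \<in> {1..}" for k
      using that by (simp add: matrix_matrix_mult_def Hhat_def block_def P gig1_def H_def)
    ultimately show "((\<lambda>k. (Hhat P i k ** B (- int k)) $ a $ b) has_sum block L i 0 $ a $ b) {1..}"
      by (subst has_sum_cong[OF entry]) (auto simp: block_def)
  qed
  have row_sums: "(\<Sum>\<^sub>\<infinity>k\<in>{1..}. block M i k) *v vec 1 = (\<chi> c. \<Sum>\<^sub>\<infinity>z\<in>-level 0. M (i, c) z)"
    if M: "\<And>x. M x summable_on - level 0" for M :: "nat \<times> 'm \<Rightarrow> nat \<times> 'm \<Rightarrow> real" and i
  proof -
    have "(block M i has_sum (\<chi> a b. \<Sum>\<^sub>\<infinity>k\<in>{1..}. M (i, a) (k, b))) {1..}"
      by (rule matrix_has_sumI) (use summable_phase[OF M] in \<open>simp add: block_def\<close>)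
    then show ?thesis
      by (simp add: infsumI vec_eq_iff matrix_vector_mult_def infsum_by_phases(2)[OF M] del: One_nat_def)
  qed
  have u: "(mat 1 + (\<Sum>\<^sub>\<infinity>k\<in>{1..}. block R 0 k)) *v vec 1 = u"
    using row_sums[of R 0] R_summable
    by (simp add: matrix_vector_mult_add_rdistrib u_def vec_eq_iff R_def H_def)
  have h: "(\<Sum>\<^sub>\<infinity>k\<in>{1..}. Hhat P i k) *v vec 1 = h i" for i
    using row_sums[of H i] hat_summable by (simp add: h_def Hhat_def[abs_def] H_def)

  have X0: "X 0 j = G ** ((if j = 0 then mat 1 else block R 0 j) - outer u (vblock \<pi> j))" for j
  proof -
    have "X 0 j $ a $ b = (\<Sum>c\<in>UNIV. G $ a $ c *
        (join_cols (level 0) id_mat R (0, c) (j, b) - u $ c * \<pi> (j, b)))" for a b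
      by (simp add: X block_def Xt_def Xt_A_def Let_def mult_on_def[of "level 0"] infsum_level
          G_def u_def R_def H_def)
    moreover have "join_cols (level 0) id_mat R (0, c) (j, b)
        = (if j = 0 then mat 1 else block R 0 j) $ c $ b" for b and c :: 'm
      by (simp add: join_cols_def id_mat_def mat_def block_def)
    ultimately show ?thesis
      by (simp add: vec_eq_iff matrix_matrix_mult_def outer_def vblock_def)
  qed
  have Xi: "X i j = block L i 0 ** X 0 j + (if j = 0 then 0 else Hhat P i j) - outer (h i) (vblock \<pi> j)"
    if "i \<ge> 1" for i j
  proof -
    have "X i j $ a $ b = (\<Sum>c\<in>UNIV. L (i, a) (0, c) * X 0 j $ c $ b)
        + join_cols (level 0) (\<lambda>_ _. 0) H (i, a) (j, b) - h i $ a * \<pi> (j, b)" for a b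
      using that
      by (simp add: X block_def Xt_def Xt_B_def Let_def mult_on_def[of "level 0"] infsum_level
          h_def L_def H_def)
    moreover have "join_cols (level 0) (\<lambda>_ _. 0) H (i, a) (j, b)
        = (if j = 0 then 0 else Hhat P i j) $ a $ b" for a b
      by (simp add: join_cols_def Hhat_def block_def H_def)
    ultimately show ?thesis
      by (simp add: vec_eq_iff matrix_matrix_mult_def outer_def vblock_def block_def)
  qed

  have \<pi>_R: "vblock \<pi> 0 v* block R 0 j = vblock \<pi> j" if "j \<ge> 1" for j
  proof -
    have "(\<Sum>c\<in>UNIV. \<pi> (0, c) * R (0, c) (j, b)) = \<pi> (j, b)" for b
      using infsumI[OF invariant_outside[of "(j, b)"]] that
      by (simp add: R_def H_def infsum_level)
    then show ?thesis
      by (simp add: vec_eq_iff vector_matrix_mult_def vblock_def block_def mult.commute)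
  qed
  have R_series: "(\<Sum>\<^sub>\<infinity>n\<in>{1..}. B (int n) ** Hhat P n j) = block R 0 j" for j
    by (rule infsumI[OF BH])
  have X00: "X 0 0 = G ** (mat 1 - (mat 1 + (\<Sum>\<^sub>\<infinity>k\<in>{1..}. \<Sum>\<^sub>\<infinity>n\<in>{1..}. B (int n) ** Hhat P n k))
                ** outer (vec 1) (vblock \<pi> 0))"
    unfolding R_series matrix_mult_outer u X0 by simp
  have X0j: "X 0 j = X 0 0 ** (\<Sum>\<^sub>\<infinity>n\<in>{1..}. B (int n) ** Hhat P n j)" if "j \<ge> 1" for j
  proof -
    have "X 0 0 ** block R 0 j = G ** ((mat 1 - outer u (vblock \<pi> 0)) ** block R 0 j)"
      by (simp only: X0 matrix_mul_assoc simp_thms if_True)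
    also have "(mat 1 - outer u (vblock \<pi> 0)) ** block R 0 j = block R 0 j - outer u (vblock \<pi> j)"
      by (simp only: matrix_diff_rdistrib matrix_mul_lid outer_mult_matrix \<pi>_R[OF that])
    also have "G ** \<dots> = X 0 j"
      using that by (simp only: X0) simp
    finally show ?thesis unfolding R_series by (rule sym)
  qed
  have L_series: "(\<Sum>\<^sub>\<infinity>k\<in>{1..}. Hhat P i k ** B (- int k)) = block L i 0" for i
    by (rule infsumI[OF HB])
  show ?thesis
  proof (intro conjI allI impI, fold G_def)
    fix i j :: nat assume "i \<ge> 1" "j \<ge> 1"
    show "X i 0 = (\<Sum>\<^sub>\<infinity>k\<in>{1..}. Hhat P i k ** B (- int k)) ** X 0 0
          - (\<Sum>\<^sub>\<infinity>k\<in>{1..}. Hhat P i k) ** outer (vec 1) (vblock \<pi> 0)"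
      unfolding L_series matrix_mult_outer h Xi[OF \<open>i \<ge> 1\<close>] by simp
    show "X i j = (\<Sum>\<^sub>\<infinity>k\<in>{1..}. Hhat P i k ** B (- int k)) ** X 0 j
          + Hhat P i j - (\<Sum>\<^sub>\<infinity>k\<in>{1..}. Hhat P i k) ** outer (vec 1) (vblock \<pi> j)"
      unfolding L_series matrix_mult_outer h Xi[OF \<open>i \<ge> 1\<close>] using \<open>j \<ge> 1\<close> by simp
  qed (rule X00, rule X0j)
qed

end
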